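(* For each integer $n\ge 3$, let $G_n$ be the random bipartite graph with $n$ vertices in each of its two partite sets, in which every pair consisting of one vertex from each partite set is an edge independently with probability $p=1/\log n$. Then there is a constant $c_1>0$ such that, with probability tending to $1$ as $n\to\infty$, $$\mathrm{box}(G_n)\ge c_1\sqrt{|E(G_n)|\,\log n/2}.$$
   Context: Graphs are finite and simple. A $d$-box is a Cartesian product $[x_1,y_1]\times\cdots\times[x_d,y_d]$ of $d$ closed intervals of the real line. The boxicity $\mathrm{box}(G)$ of a graph $G$ is the smallest integer $d\ge 1$ such that $G$ is the intersection graph of a collection of $d$-boxes, i.e. one can assign to each vertex $v$ a $d$-box $B_v$ such that two distinct vertices $u,v$ are adjacent if and only if $B_u\cap B_v\neq\emptyset$ (distinct vertices may be assigned the same box). $E(G)$ denotes the edge set of $G$. The logarithm is natural. *)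

theory Defs
  imports "HOL-Probability.Probability"
begin

datatype 'a graph = Graph (verts: "'a set") (edges: "'a set set")

definition finite_simple_graph :: "'a graph \<Rightarrow> bool" where
  "finite_simple_graph G \<longleftrightarrow>
     finite (verts G) \<and> (\<forall>e\<in>edges G. e \<subseteq> verts G \<and> card e = 2)"

text \<open>
  Points of $d$-dimensional space are extensional functions on \<open>{..<d}\<close>, so that \<open>d\<close> may
  range over the natural numbers. Closed intervals are nonempty (\<open>x i \<le> y i\<close>).
\<close>

definition is_box :: "nat \<Rightarrow> (nat \<Rightarrow> real) set \<Rightarrow> bool" where
  "is_box d B \<longleftrightarrow> (\<exists>x y. (\<forall>i<d. x i \<le> y i) \<and> B = (\<Pi>\<^sub>E i\<in>{..<d}. {x i..y i}))"

definition box_representation :: "nat \<Rightarrow> 'a graph \<Rightarrow> ('a \<Rightarrow> (nat \<Rightarrow> real) set) \<Rightarrow> bool" where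
  "box_representation d G B \<longleftrightarrow>
     (\<forall>v\<in>verts G. is_box d (B v)) \<and>
     (\<forall>u\<in>verts G. \<forall>v\<in>verts G. u \<noteq> v \<longrightarrow> ({u, v} \<in> edges G \<longleftrightarrow> B u \<inter> B v \<noteq> {}))"

definition boxicity :: "'a graph \<Rightarrow> nat" where
  "boxicity G = (LEAST d. 1 \<le> d \<and> (\<exists>B. box_representation d G B))"

text \<open>
  The minimum is taken over a nonempty set: give each vertex \<open>w\<close> its own coordinate, in which
  \<open>w\<close> gets $[0,0]$, its neighbours get $[0,1]$ and all other vertices get $[1,1]$.
\<close>

lemma box_representation_exists:
  assumes "finite_simple_graph G"
  shows "\<exists>d\<ge>1. \<exists>B. box_representation d G B"
proof -
  have "finite (verts G)"
    using assms by (simp add: finite_simple_graph_def)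
  then obtain f where f: "bij_betw f {..<card (verts G)} (verts G)"
    using ex_bij_betw_nat_finite[of "verts G"] by (auto simp: atLeast0LessThan)
  define d where "d = Suc (card (verts G))"
  define lo where
    "lo = (\<lambda>v i. if i < card (verts G) \<and> v \<noteq> f i \<and> {v, f i} \<notin> edges G then 1 else (0::real))"
  define hi where
    "hi = (\<lambda>v i. if i < card (verts G) \<and> v = f i then 0 else (1::real))"
  define B where "B = (\<lambda>v. \<Pi>\<^sub>E i\<in>{..<d}. {lo v i..hi v i})"
  have "is_box d (B v)" for v
  proof -
    have "\<forall>i<d. lo v i \<le> hi v i"
      by (simp add: lo_def hi_def)
    then show ?thesis
      unfolding is_box_def B_def by blast
  qed
  moreover have "{u, v} \<in> edges G \<longleftrightarrow> B u \<inter> B v \<noteq> {}"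
    if uv: "u \<in> verts G" "v \<in> verts G" "u \<noteq> v" for u v
  proof
    assume e: "{u, v} \<in> edges G"
    have e': "{v, u} \<in> edges G"
      using e insert_commute[of u v "{}"] by simp
    define z where "z = (\<lambda>i\<in>{..<d}. max (lo u i) (lo v i))"
    have "max (lo u i) (lo v i) \<le> hi u i \<and> max (lo u i) (lo v i) \<le> hi v i" for i
      using e e' uv(3) by (cases "f i = u"; cases "f i = v") (simp_all add: lo_def hi_def)
    then have "z \<in> B u \<inter> B v"
      by (simp add: z_def B_def PiE_iff)
    then show "B u \<inter> B v \<noteq> {}" by blast
  next
    assume "B u \<inter> B v \<noteq> {}"
    then obtain z where z: "z \<in> B u" "z \<in> B v" by blast
    have "v \<in> f ` {..<card (verts G)}"
      using uv(2) by (simp only: bij_betw_imp_surj_on[OF f])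
    then obtain i where i: "i < card (verts G)" "f i = v"
      by (metis imageE lessThan_iff)
    have "i < d"
      using i(1) by (simp add: d_def)
    then have "lo u i \<le> z i" "z i \<le> hi v i"
      using z by (simp_all add: B_def PiE_iff)
    then have "lo u i \<le> 0"
      using i by (simp add: hi_def)
    then show "{u, v} \<in> edges G"
      using i uv(3) by (simp add: lo_def split: if_splits)
  qed
  ultimately have "box_representation d G B"
    by (simp add: box_representation_def)
  then show ?thesis
    by (intro exI[of _ d]) (auto simp: d_def)
qed

definition bipartite_graph_of :: "nat \<Rightarrow> (nat \<times> nat \<Rightarrow> bool) \<Rightarrow> (nat + nat) graph" where
  "bipartite_graph_of n X =
     Graph ({..<n} <+> {..<n}) {{Inl i, Inr j} | i j. i < n \<and> j < n \<and> X (i, j)}"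

text \<open>
  \<open>Pi_pmf A False (\<lambda>_. bernoulli_pmf p)\<close> is the law of a family of independent Bernoulli
  variables indexed by \<open>A\<close>. Note that \<open>bernoulli_pmf\<close> is only meaningful for \<open>0 \<le> p \<le> 1\<close>,
  which for \<open>p = 1 / ln n\<close> means \<open>n \<ge> 3\<close>.
\<close>

definition random_bipartite_graph :: "nat \<Rightarrow> real \<Rightarrow> (nat + nat) graph pmf" where
  "random_bipartite_graph n p =
     map_pmf (bipartite_graph_of n) (Pi_pmf ({..<n} \<times> {..<n}) False (\<lambda>_. bernoulli_pmf p))"

lemma finite_simple_random_bipartite_graph:
  assumes "G \<in> set_pmf (random_bipartite_graph n p)"
  shows "finite_simple_graph G"
  using assms
  by (auto simp: random_bipartite_graph_def bipartite_graph_of_def finite_simple_graph_def)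

end

theory Submission
  imports Defs "HOL-Real_Asymp.Real_Asymp"
begin

text \<open>
  Write $l = \ln n$ and $p = 1/l$. With high probability there are fewer than $3pn^2$ edges
  (\<open>prob_coins_many\<close>), so that $\sqrt{|E|\,l/2} \le 2n$, and it is enough that the boxicity is
  at least $n/256$.

  In a $d$-dimensional representation, a nonadjacent pair of a row $a$ and a column $b$ is separated
  in some coordinate, by one of the two boxes lying to the left of the other. This gives $2d$
  relations of the form $f_k(a) < g_k(b)$ that contain no edge and cover all non-edges. If such a
  relation contains $(a,b)$, it contains the whole rectangle spanned by the rows with smaller $f_k$
  and the columns with larger $g_k$. With high probability no $L \times L$ square is free of edges,
  where $L \approx 3l^2$ (\<open>prob_empty_square_le\<close>); hence $a$ or $b$ is among the first $L$ rows or
  columns of the relation, and all that matters about it are these two rankings of length $L$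
  (\<open>covering_of_box_representation\<close>). For $D \le n/128$ relations there are only
  $n^{2DL} = \exp(O(n l^3))$ choices of rankings, so a union bound succeeds once every fixed
  choice covers all non-edges with probability at most $\exp(-n^{3/2}/l^{O(1)})$. That is
  \<open>prob_covering_le\<close>, the heart of the proof.

  Fix the rankings. Ranking $k$ covers $(a,b)$ through $a$ only if $b$ has no neighbour in the set
  $T_k(a)$ of rows ranked before $a$, which has probability $(1-p)^{|T_k(a)|}$. Each ranking has only
  one row at each position, so an average row satisfies
  $\sum_k -\ln(1-(1-p)^{|T_k(a)|}) \le (D/n) \sum_{t\ge1} -\ln(1-(1-p)^t) \le 3D/(np)$,
  a small multiple of $l$. By Harris' inequality $b$ then has a neighbour in all the sets $T_k(a)$
  with probability at least $n^{-1/4}$; the same holds for columns, and a pair of a good row and a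
  good column is an uncovered non-edge with probability at least $n^{-1/2}/2$.

  It remains to find about $n^2$ pairs for which these events are independent. Rows that occur in
  more than $L$ rankings are few, and they can be deleted from the sets $T_k(a)$: the positions among
  the remaining rows are still distinct within each ranking, so the estimate above survives. After
  the deletion every row lies in few of the sets, so a greedy choice gives $n/l^{O(1)}$ good rows
  whose sets are disjoint (\<open>disjoint_light_rows\<close>), and likewise for the columns. The events of
  the $n^2/l^{O(1)}$ pairs then depend on disjoint sets of edges.
\<close>

section \<open>Independent Bernoulli variables\<close>

abbreviation coins :: "'a set \<Rightarrow> real \<Rightarrow> ('a \<Rightarrow> bool) pmf" where
  "coins A p \<equiv> Pi_pmf A False (\<lambda>_. bernoulli_pmf p)"

lemma prob_bind_bernoulli:
  assumes "0 \<le> p" "p \<le> 1"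
  shows "measure_pmf.prob (bernoulli_pmf p \<bind> f) S =
           p * measure_pmf.prob (f True) S + (1 - p) * measure_pmf.prob (f False) S"
proof -
  have "measure_pmf.prob (bernoulli_pmf p \<bind> f) S =
          (\<integral>y. measure_pmf.prob (f y) S \<partial>bernoulli_pmf p)"
    unfolding bind_pmf.rep_eq
    by (subst measure_pmf.measure_bind[where N = "count_space UNIV"]) (auto simp: measure_subprob)
  then show ?thesis using assms by simp
qed

lemma prob_coins_insert:
  assumes "finite A" "x \<notin> A" "0 \<le> p" "p \<le> 1"
  shows "measure_pmf.prob (coins (insert x A) p) S =
           p * measure_pmf.prob (coins A p) {X. X(x := True) \<in> S} +
           (1 - p) * measure_pmf.prob (coins A p) {X. X(x := False) \<in> S}"
proof -
  have "coins (insert x A) p = bernoulli_pmf p \<bind> (\<lambda>y. map_pmf (\<lambda>X. X(x := y)) (coins A p))"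
    using assms by (simp add: Pi_pmf_insert' map_pmf_def)
  then show ?thesis
    using assms by (simp add: prob_bind_bernoulli vimage_def)
qed

definition determined_by :: "'a set \<Rightarrow> ('a \<Rightarrow> bool) set \<Rightarrow> bool" where
  "determined_by V S \<longleftrightarrow> (\<forall>X Y. (\<forall>v\<in>V. X v = Y v) \<longrightarrow> (X \<in> S \<longleftrightarrow> Y \<in> S))"

lemma determined_by_upd: "determined_by V S \<Longrightarrow> determined_by V {X. X(x := y) \<in> S}"
  unfolding determined_by_def by (auto simp: fun_upd_def)

lemma determined_by_upd_outside: "determined_by V S \<Longrightarrow> x \<notin> V \<Longrightarrow> {X. X(x := y) \<in> S} = S"
  unfolding determined_by_def by (metis (mono_tags, lifting) Collect_cong Collect_mem_eq fun_upd_other)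

lemma determined_by_mono: "determined_by V S \<Longrightarrow> V \<subseteq> W \<Longrightarrow> determined_by W S"
  unfolding determined_by_def by blast

lemma determined_by_Compl: "determined_by V S \<Longrightarrow> determined_by V (- S)"
  unfolding determined_by_def by blast

lemma determined_by_Int: "determined_by V S \<Longrightarrow> determined_by V T \<Longrightarrow> determined_by V (S \<inter> T)"
  unfolding determined_by_def by blast

lemma determined_by_INT:
  "(\<And>i. i \<in> I \<Longrightarrow> determined_by V (S i)) \<Longrightarrow> determined_by V (\<Inter>i\<in>I. S i)"
  unfolding determined_by_def by blast

text \<open>
  Induction on the coins: the coin that is added is irrelevant for one of the two events, so
  conditioning on it factorises.
\<close>

lemma prob_coins_indep:
  assumes "finite A" "0 \<le> p" "p \<le> 1"
    and "determined_by V S" "determined_by W T" "V \<inter> W = {}"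
  shows "measure_pmf.prob (coins A p) (S \<inter> T) =
           measure_pmf.prob (coins A p) S * measure_pmf.prob (coins A p) T"
  using assms(1,4,5)
proof (induction A arbitrary: S T rule: finite_induct)
  case empty
  then show ?case by (auto simp: measure_return_pmf indicator_def)
next
  case (insert x A)
  define up where "up = (\<lambda>S y. {X. (X :: 'a \<Rightarrow> bool)(x := y) \<in> S})"
  have split: "measure_pmf.prob (coins (insert x A) p) S =
      p * measure_pmf.prob (coins A p) (up S True) + (1 - p) * measure_pmf.prob (coins A p) (up S False)" for S
    using prob_coins_insert[OF insert.hyps assms(2,3)] by (simp add: up_def)
  have up_Int: "up (S \<inter> T) y = up S y \<inter> up T y" for y
    by (auto simp: up_def)
  have IH: "measure_pmf.prob (coins A p) (up S y \<inter> up T y) =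
      measure_pmf.prob (coins A p) (up S y) * measure_pmf.prob (coins A p) (up T y)" for y
    unfolding up_def by (intro insert.IH determined_by_upd insert.prems)
  consider "x \<notin> V" | "x \<notin> W" using assms(6) by blast
  then show ?case
  proof cases
    case 1
    then have "up S y = S" for y
      unfolding up_def by (rule determined_by_upd_outside[OF insert.prems(1)])
    then show ?thesis using IH by (simp add: split up_Int algebra_simps)
  next
    case 2
    then have "up T y = T" for y
      unfolding up_def by (rule determined_by_upd_outside[OF insert.prems(2)])
    then show ?thesis using IH by (simp add: split up_Int algebra_simps)
  qed
qed

lemma prob_coins_none:
  assumes "finite A" "0 \<le> p" "p \<le> 1" "finite I"
    and "\<And>i. i \<in> I \<Longrightarrow> determined_by (V i) (S i)"
    and "disjoint_family_on V I"
  shows "measure_pmf.prob (coins A p) (\<Inter>i\<in>I. - S i) =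
           (\<Prod>i\<in>I. 1 - measure_pmf.prob (coins A p) (S i))"
  using assms(4-6)
proof (induction I rule: finite_induct)
  case empty
  then show ?case by simp
next
  case (insert i I)
  have "V i \<inter> (\<Union>j\<in>I. V j) = {}"
    using insert.hyps insert.prems(2) by (fastforce simp: disjoint_family_on_def)
  moreover have "determined_by (\<Union>j\<in>I. V j) (\<Inter>j\<in>I. - S j)"
    using insert.prems(1) by (intro determined_by_INT determined_by_Compl) (blast intro: determined_by_mono)
  moreover have "determined_by (V i) (- S i)"
    using insert.prems(1) by (simp add: determined_by_Compl)
  ultimately have "measure_pmf.prob (coins A p) (- S i \<inter> (\<Inter>j\<in>I. - S j)) =
      measure_pmf.prob (coins A p) (- S i) * measure_pmf.prob (coins A p) (\<Inter>j\<in>I. - S j)"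
    using prob_coins_indep[OF assms(1-3)] by blast
  moreover have "measure_pmf.prob (coins A p) (- S i) = 1 - measure_pmf.prob (coins A p) (S i)"
    using measure_pmf.prob_compl[of "S i" "coins A p"] by (simp add: Compl_eq_Diff_UNIV)
  moreover have "measure_pmf.prob (coins A p) (\<Inter>j\<in>I. - S j) = (\<Prod>j\<in>I. 1 - measure_pmf.prob (coins A p) (S j))"
    using insert.prems by (intro insert.IH) (auto simp: disjoint_family_on_def)
  ultimately show ?case using insert.hyps by simp
qed

definition up_closed :: "('a \<Rightarrow> bool) set \<Rightarrow> bool" where
  "up_closed S \<longleftrightarrow> (\<forall>X Y. X \<le> Y \<longrightarrow> X \<in> S \<longrightarrow> Y \<in> S)"

lemma up_closed_INT: "(\<And>i. i \<in> I \<Longrightarrow> up_closed (S i)) \<Longrightarrow> up_closed (\<Inter>i\<in>I. S i)"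
  unfolding up_closed_def by blast

lemma up_closed_upd: "up_closed S \<Longrightarrow> up_closed {X. X(x := y) \<in> S}"
  unfolding up_closed_def mem_Collect_eq
proof (intro allI impI)
  fix X Y :: "'a \<Rightarrow> bool"
  assume S: "\<forall>X Y. X \<le> Y \<longrightarrow> X \<in> S \<longrightarrow> Y \<in> S" and "X \<le> Y" "X(x := y) \<in> S"
  moreover have "X(x := y) \<le> Y(x := y)"
    using \<open>X \<le> Y\<close> by (simp add: le_fun_def)
  ultimately show "Y(x := y) \<in> S" using S[rule_format, of "X(x := y)" "Y(x := y)"] by simp
qed

text \<open>
  Harris' inequality. Conditioning on one coin, with $s_1 \ge s_0$ and $t_1 \ge t_0$ the conditional
  probabilities of the two events, the induction step is
  $p s_1 t_1 + (1-p) s_0 t_0 - (p s_1 + (1-p) s_0)(p t_1 + (1-p) t_0) = p(1-p)(s_1-s_0)(t_1-t_0) \ge 0$.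
\<close>

lemma harris:
  assumes "finite A" "0 \<le> p" "p \<le> 1" "up_closed S" "up_closed T"
  shows "measure_pmf.prob (coins A p) S * measure_pmf.prob (coins A p) T
           \<le> measure_pmf.prob (coins A p) (S \<inter> T)"
  using assms(1,4,5)
proof (induction A arbitrary: S T rule: finite_induct)
  case empty
  then show ?case by (auto simp: measure_return_pmf indicator_def)
next
  case (insert x A)
  define up where "up = (\<lambda>S y. {X. (X :: 'a \<Rightarrow> bool)(x := y) \<in> S})"
  define s t where "s = (\<lambda>y. measure_pmf.prob (coins A p) (up S y))"
    and "t = (\<lambda>y. measure_pmf.prob (coins A p) (up T y))"
  have split: "measure_pmf.prob (coins (insert x A) p) S =
      p * measure_pmf.prob (coins A p) (up S True) + (1 - p) * measure_pmf.prob (coins A p) (up S False)" for S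
    using prob_coins_insert[OF insert.hyps assms(2,3)] by (simp add: up_def)
  have up_Int: "up (S \<inter> T) y = up S y \<inter> up T y" for y
    by (auto simp: up_def)
  have IH: "s y * t y \<le> measure_pmf.prob (coins A p) (up S y \<inter> up T y)" for y
    unfolding up_def s_def t_def by (intro insert.IH up_closed_upd insert.prems)
  have mono: "up S False \<subseteq> up S True" if "up_closed S" for S
  proof
    fix X assume "X \<in> up S False"
    moreover have "X(x := False) \<le> X(x := True)" by (simp add: le_fun_def)
    ultimately show "X \<in> up S True"
      using that[unfolded up_closed_def, rule_format, of "X(x := False)" "X(x := True)"]
      by (simp add: up_def)
  qed
  have "s False \<le> s True" "t False \<le> t True"
    unfolding s_def t_def by (intro measure_pmf.finite_measure_mono mono insert.prems; simp)+
  then have "0 \<le> p * (1 - p) * ((s True - s False) * (t True - t False))"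
    using assms(2,3) by simp
  then have "(p * s True + (1 - p) * s False) * (p * t True + (1 - p) * t False)
      \<le> p * (s True * t True) + (1 - p) * (s False * t False)"
    by (simp add: algebra_simps)
  also have "\<dots> \<le> p * measure_pmf.prob (coins A p) (up S True \<inter> up T True) +
      (1 - p) * measure_pmf.prob (coins A p) (up S False \<inter> up T False)"
    using assms(2,3) by (intro add_mono mult_left_mono IH) auto
  finally show ?case by (simp add: split up_Int s_def t_def)
qed

lemma harris_INT:
  assumes "finite A" "0 \<le> p" "p \<le> 1" "finite I" "\<And>i. i \<in> I \<Longrightarrow> up_closed (S i)"
  shows "(\<Prod>i\<in>I. measure_pmf.prob (coins A p) (S i)) \<le> measure_pmf.prob (coins A p) (\<Inter>i\<in>I. S i)"
  using assms(4,5)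
proof (induction I rule: finite_induct)
  case empty
  then show ?case by simp
next
  case (insert i I)
  have "(\<Prod>i\<in>insert i I. measure_pmf.prob (coins A p) (S i)) \<le>
      measure_pmf.prob (coins A p) (S i) * measure_pmf.prob (coins A p) (\<Inter>i\<in>I. S i)"
    using insert by (auto intro!: mult_left_mono)
  also have "\<dots> \<le> measure_pmf.prob (coins A p) (S i \<inter> (\<Inter>i\<in>I. S i))"
    using insert.prems by (intro harris assms(1-3) up_closed_INT) auto
  finally show ?case by simp
qed

lemma prob_coins_all_False:
  assumes "finite A" "0 \<le> p" "p \<le> 1" "T \<subseteq> A"
  shows "measure_pmf.prob (coins A p) {X. \<forall>x\<in>T. \<not> X x} = (1 - p) ^ card T"
proof -
  have eq: "{X. \<forall>x\<in>T. \<not> X x} = Pi A (\<lambda>x. if x \<in> T then {False} else UNIV)"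
    using assms(4) by (auto simp: Pi_def)
  have "measure_pmf.prob (coins A p) {X. \<forall>x\<in>T. \<not> X x} = 
      (\<Prod>x\<in>A. measure_pmf.prob (bernoulli_pmf p) (if x \<in> T then {False} else UNIV))"
    unfolding eq by (rule measure_Pi_pmf_Pi[OF assms(1)])
  also have "\<dots> = (\<Prod>x\<in>A. if x \<in> T then 1 - p else 1)"
    using assms(2,3) by (intro prod.cong) (auto simp: measure_pmf_single)
  also have "\<dots> = (1 - p) ^ card T"
    using assms(1,4) by (simp add: prod.If_cases Int_absorb1)
  finally show ?thesis .
qed

lemma prob_coins_hit:
  assumes "finite A" "0 \<le> p" "p \<le> 1" "T \<subseteq> A"
  shows "measure_pmf.prob (coins A p) {X. \<exists>x\<in>T. X x} = 1 - (1 - p) ^ card T"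
proof -
  have "{X. \<exists>x\<in>T. X x} = UNIV - {X. \<forall>x\<in>T. \<not> X x}" by auto
  then show ?thesis
    using measure_pmf.prob_compl[of "{X. \<forall>x\<in>T. \<not> X x}" "coins A p"]
      prob_coins_all_False[OF assms] by simp
qed

text \<open>
  Markov's inequality for $e^N$, where $N$ is the number of heads:
  its expectation $(1 + (e-1)p)^{|A|}$ is at most $e^{2p|A|}$.
\<close>

lemma prob_coins_many:
  assumes "finite A" "0 \<le> p" "p \<le> 1"
  shows "measure_pmf.prob (coins A p) {X. real (card {x\<in>A. X x}) \<ge> 3 * p * real (card A)}
           \<le> exp (- (p * real (card A)))"
proof -
  let ?f = "\<lambda>X. \<Prod>x\<in>A. if X x then exp 1 else (1 :: real)"
  let ?N = "real (card A)"
  have f: "?f X = exp (real (card {x\<in>A. X x}))" for X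
    using assms(1) by (simp add: prod.If_cases Int_def exp_of_nat_mult[symmetric])
  have int: "integrable (coins A p) ?f"
    by (rule integrable_prod_Pi_pmf[OF assms(1)]) (auto intro: integrable_measure_pmf_finite)
  have "{X. real (card {x\<in>A. X x}) \<ge> 3 * p * ?N} = {X\<in>space (coins A p). exp (3 * p * ?N) \<le> ?f X}"
    by (simp only: f) simp
  then have "measure_pmf.prob (coins A p) {X. real (card {x\<in>A. X x}) \<ge> 3 * p * ?N} \<le>
      measure_pmf.expectation (coins A p) ?f / exp (3 * p * ?N)"
    using integral_Markov_inequality_measure[OF int, of UNIV "exp (3 * p * ?N)"]
    by (simp add: prod_nonneg)
  also have "measure_pmf.expectation (coins A p) ?f = (1 + p * (exp 1 - 1)) ^ card A"
    using assms by (subst expectation_prod_Pi_pmf[where f = "\<lambda>_ v. if v then exp 1 else (1::real)"])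
      (auto intro: integrable_measure_pmf_finite simp: algebra_simps)
  also have "\<dots> \<le> exp (2 * p) ^ card A"
  proof (rule power_mono)
    have "1 + p * (exp 1 - 1) \<le> 1 + 2 * p"
      using e_less_272 assms(2) mult_left_mono[of "exp 1 - 1" 2 p] by simp
    then show "1 + p * (exp 1 - 1) \<le> exp (2 * p)"
      using exp_ge_add_one_self[of "2 * p"] by linarith
    show "0 \<le> 1 + p * (exp 1 - 1)" using assms(2) by simp
  qed
  also have "\<dots> / exp (3 * p * ?N) = exp (- (p * ?N))"
    by (simp add: exp_of_nat_mult[symmetric] exp_diff[symmetric] algebra_simps)
  finally show ?thesis by (simp add: divide_right_mono)
qed

section \<open>Disjoint hitting sets from rankings\<close>

lemma card_UN_le_mult:
  assumes "finite I" "\<And>i. i \<in> I \<Longrightarrow> card (A i) \<le> m"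
  shows "card (\<Union>i\<in>I. A i) \<le> card I * m"
proof -
  have "card (\<Union>i\<in>I. A i) \<le> (\<Sum>i\<in>I. card (A i))" by (rule card_UN_le[OF assms(1)])
  also have "\<dots> \<le> card I * m" using assms(2) by (intro sum_bounded_above[where K = m, simplified]) auto
  finally show ?thesis .
qed

text \<open>
  A maximal disjoint subfamily meets every member of the family, and the points it occupies,
  at most \<open>m\<close> per member, can each be blamed for at most \<open>m\<close> members.
\<close>

lemma disjoint_subfamily:
  fixes U :: "'a \<Rightarrow> 'b set"
  assumes fin: "finite G"
    and U: "\<And>a. a \<in> G \<Longrightarrow> finite (U a) \<and> card (U a) \<le> m \<and> U a \<noteq> {}"
    and deg: "\<And>x. x \<in> (\<Union>a\<in>G. U a) \<Longrightarrow> card {a\<in>G. x \<in> U a} \<le> m"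
  shows "\<exists>A\<subseteq>G. disjoint_family_on U A \<and> card G \<le> card A * m\<^sup>2"
proof -
  let ?\<A> = "{A. A \<subseteq> G \<and> disjoint_family_on U A}"
  have "finite ?\<A>" using fin by simp
  moreover have "{} \<in> ?\<A>" by (simp add: disjoint_family_on_def)
  ultimately obtain A where A: "A \<in> ?\<A>" and max: "\<And>B. B \<in> ?\<A> \<Longrightarrow> A \<subseteq> B \<Longrightarrow> A = B"
    by (metis (no_types, lifting) finite_has_maximal2)
  have finA: "finite A" using A fin finite_subset by blast
  have "G \<subseteq> (\<Union>x\<in>(\<Union>a\<in>A. U a). {a\<in>G. x \<in> U a})"
  proof
    fix g assume g: "g \<in> G"
    have "\<exists>a\<in>A. U g \<inter> U a \<noteq> {}"
    proof (rule ccontr)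
      assume no: "\<not> ?thesis"
      then have "insert g A \<in> ?\<A>"
        using A g by (auto simp: disjoint_family_on_def)
      then have "g \<in> A" using max by blast
      then show False using no U[OF g] by blast
    qed
    then show "g \<in> (\<Union>x\<in>(\<Union>a\<in>A. U a). {a\<in>G. x \<in> U a})" using g by blast
  qed
  moreover have finU: "finite (\<Union>a\<in>A. U a)" using A U finA by auto
  ultimately have "card G \<le> card (\<Union>x\<in>(\<Union>a\<in>A. U a). {a\<in>G. x \<in> U a})"
    by (intro card_mono) (auto intro: finite_subset[OF _ fin])
  also have "\<dots> \<le> card (\<Union>a\<in>A. U a) * m"
    using A by (intro card_UN_le_mult[OF finU] deg) auto
  also have "card (\<Union>a\<in>A. U a) \<le> card A * m"
    using A U by (intro card_UN_le_mult[OF finA]) auto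
  finally show ?thesis using A by (intro exI[of _ A]) (simp add: power2_eq_square mult.assoc)
qed

text \<open>
  \<open>P (k, i)\<close> is the element at position \<open>i\<close> of the ranking \<open>k\<close>; only the first \<open>L\<close> positions
  are recorded.
\<close>

definition rankings :: "nat \<Rightarrow> nat \<Rightarrow> nat \<Rightarrow> (nat \<times> nat \<Rightarrow> nat) \<Rightarrow> bool" where
  "rankings n D L P \<longleftrightarrow> (\<forall>k<D. inj_on (\<lambda>i. P (k, i)) {..<L} \<and> (\<forall>i<L. P (k, i) < n))"

text \<open>
  The set \<open>T a k\<close> consists of rows ranked before \<open>a\<close> in the ranking \<open>k\<close>, and \<open>U a\<close> collects \<open>a\<close>
  together with all of them. The weight \<open>w t\<close> stands for the negative logarithm of the probability to meet a set of size \<open>t\<close>.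
  Three kinds of rows are discarded: the set \<open>H\<close> of rows occurring in more than \<open>L\<close> rankings, which
  would make the sets \<open>U a\<close> overlap; the rows in \<open>Z\<close>, for which nothing is left of some \<open>T a k\<close>
  once \<open>H\<close> is removed; and the rows of large total weight. The first two kinds have at most \<open>D\<close>
  members each, the last at most $n/8$ by averaging, so half of the rows survive.
\<close>

lemma disjoint_light_rows:
  fixes P :: "nat \<times> nat \<Rightarrow> nat" and w :: "nat \<Rightarrow> real"
  assumes D: "128 * D \<le> n"
    and ranking: "rankings n D L P"
    and w: "\<And>t. 0 \<le> w t" "real D * (\<Sum>t=1..L. w t) \<le> M * real n / 8" "0 < M"
  obtains A U T where "A \<subseteq> {..<n}" "disjoint_family_on U A"
    "real n / 2 \<le> real (card A) * (1 + real L ^ 2) ^ 2"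
    "\<forall>a\<in>A. U a \<subseteq> {..<n} \<and> a \<in> U a"
    "\<forall>a\<in>A. (\<Sum>k | k < D \<and> (\<exists>i<L. P (k, i) = a). w (card (T a k))) \<le> M"
    "\<forall>a\<in>A. \<forall>k<D. \<forall>i<L. P (k, i) = a \<longrightarrow>
       T a k \<noteq> {} \<and> T a k \<subseteq> U a - {a} \<and> T a k \<subseteq> {P (k, j) | j. j < i}"
proof -
  have P: "P (k, i) < n" and inj: "inj_on (\<lambda>i. P (k, i)) {..<L}" if "k < D" "i < L" for k i
    using ranking that by (auto simp: rankings_def)
  define K where "K = (\<lambda>a. {k. k < D \<and> (\<exists>i<L. P (k, i) = a)})"
  define R where "R = (\<lambda>k. (\<lambda>i. P (k, i)) ` {..<L})"
  define H where "H = {a. L < card (K a)}"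
  define T where "T = (\<lambda>a k. {P (k, j) | j i. j < i \<and> i < L \<and> P (k, i) = a} - H)"
  define U where "U = (\<lambda>a. insert a (\<Union>k\<in>K a. T a k))"
  define Z where "Z = (\<Union>k<D. {a \<in> R k - H. T a k = {}})"
  define load where "load = (\<lambda>a. \<Sum>k\<in>K a. w (card (T a k)))"
  define G where "G = {a. a < n \<and> a \<notin> H \<and> a \<notin> Z \<and> load a \<le> M}"
  have K_iff: "k \<in> K a \<longleftrightarrow> k < D \<and> a \<in> R k" for k a
    by (auto simp: K_def R_def)
  have finK [simp]: "finite (K a)" for a
    by (rule finite_subset[of _ "{..<D}"]) (auto simp: K_def)
  have finR [simp]: "finite (R k)" and cardR: "card (R k) \<le> L" for k
    using card_image_le[of "{..<L}" "\<lambda>i. P (k, i)"] by (auto simp: R_def)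
  have T_eq: "T a k = {P (k, j) | j. j < i} - H" if "k < D" "i < L" "P (k, i) = a" for a k i
  proof -
    have "i' = i" if "i' < L" "P (k, i') = a" for i'
      using inj_onD[OF inj[OF \<open>k < D\<close> \<open>i < L\<close>], of i' i] that \<open>i < L\<close> \<open>P (k, i) = a\<close> by simp
    then show ?thesis unfolding T_def using that by blast
  qed
  have T_sub: "T a k \<subseteq> R k" for a k
    by (auto simp: T_def R_def)
  have finT [simp]: "finite (T a k)" and cardT: "card (T a k) \<le> L" for a k
    by (rule finite_subset[OF T_sub finR]) (rule order_trans[OF card_mono[OF finR T_sub] cardR])
  have R_lt: "a < n" if "k < D" "a \<in> R k" for a k
    using that P by (auto simp: R_def)
  have K_out: "K a = {}" if "n \<le> a" for a
    using R_lt that by (fastforce simp: K_iff)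
  have H_lt: "H \<subseteq> {..<n}"
  proof
    fix a assume "a \<in> H"
    then have "K a \<noteq> {}" by (auto simp: H_def)
    then show "a \<in> {..<n}" using K_out[of a] by (cases "a < n") auto
  qed
  have double: "(\<Sum>a<n. \<Sum>k\<in>K a. f a k) = (\<Sum>k<D. \<Sum>a\<in>R k. f a k)" for f :: "nat \<Rightarrow> nat \<Rightarrow> real"
  proof -
    have "(\<Sum>a<n. \<Sum>k\<in>K a. f a k) = (\<Sum>(a, k)\<in>Sigma {..<n} K. f a k)"
      by (rule sum.Sigma) auto
    also have "\<dots> = (\<Sum>(k, a)\<in>Sigma {..<D} R. f a k)"
      by (rule sum.reindex_bij_witness[of _ "\<lambda>(k, a). (a, k)" "\<lambda>(a, k). (k, a)"])
        (auto simp: K_iff R_lt)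
    also have "\<dots> = (\<Sum>k<D. \<Sum>a\<in>R k. f a k)"
      by (rule sum.Sigma[symmetric]) auto
    finally show ?thesis .
  qed
  \<comment> \<open>Deleting \<open>H\<close> keeps the positions distinct, since a surviving row still counts for all later ones.\<close>
  have injT: "inj_on (\<lambda>a. card (T a k)) (R k - H)" if k: "k < D" for k
  proof -
    have less: "card (T (P (k, i)) k) < card (T (P (k, i')) k)"
      if "i < i'" "i' < L" "P (k, i) \<notin> H" for i i'
    proof (rule psubset_card_mono)
      have "i < L" using that by simp
      have "P (k, i) \<notin> T (P (k, i)) k"
        using inj_onD[OF inj[OF k \<open>i < L\<close>]] \<open>i < L\<close> by (fastforce simp: T_eq[OF k \<open>i < L\<close> refl])
      moreover have "P (k, i) \<in> T (P (k, i')) k"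
        using that by (auto simp: T_eq[OF k \<open>i' < L\<close> refl])
      moreover have "T (P (k, i)) k \<subseteq> T (P (k, i')) k"
        using that by (auto simp: T_eq[OF k \<open>i' < L\<close> refl] T_eq[OF k \<open>i < L\<close> refl])
      ultimately show "T (P (k, i)) k \<subset> T (P (k, i')) k" by blast
    qed simp
    show ?thesis
    proof (rule inj_onI)
      fix a a' assume a: "a \<in> R k - H" "a' \<in> R k - H" and eq: "card (T a k) = card (T a' k)"
      then obtain i i' where i: "i < L" "a = P (k, i)" "i' < L" "a' = P (k, i')"
        by (auto simp: R_def)
      consider "i < i'" | "i' < i" | "i = i'" by linarith
      then show "a = a'"
        using less[of i i'] less[of i' i] a eq i by cases auto
    qed
  qed
  \<comment> \<open>The \<open>D\<close> rankings have only \<open>D * L\<close> entries altogether.\<close>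
  have "card H * (L + 1) \<le> D * L"
  proof -
    have "real (card H * (L + 1)) = (\<Sum>a\<in>H. real (L + 1))" by (simp add: algebra_simps)
    also have "\<dots> \<le> (\<Sum>a\<in>H. real (card (K a)))"
      by (intro sum_mono) (simp add: H_def Suc_le_eq flip: of_nat_Suc)
    also have "\<dots> \<le> (\<Sum>a<n. real (card (K a)))"
      using H_lt by (intro sum_mono2) auto
    also have "\<dots> = (\<Sum>k<D. real (card (R k)))"
      using double[of "\<lambda>_ _. 1"] by simp
    also have "\<dots> \<le> real D * real L"
      using cardR by (intro sum_bounded_above[where A = "{..<D}", simplified]) auto
    finally show ?thesis by (simp flip: of_nat_mult)
  qed
  moreover have "D * L < (D + 1) * (L + 1)" by simp
  ultimately have "card H * (L + 1) < (D + 1) * (L + 1)" by linarith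
  then have cardH: "card H \<le> D" by (subst (asm) mult_less_cancel2) simp
  \<comment> \<open>Only the first surviving row of a ranking has no surviving predecessor.\<close>
  have "card {a \<in> R k - H. T a k = {}} \<le> 1" if "k < D" for k
    using inj_onD[OF injT[OF that]] by (simp add: card_le_Suc0_iff_eq)
  then have cardZ: "card Z \<le> D"
    unfolding Z_def using card_UN_le_mult[of "{..<D}" "\<lambda>k. {a \<in> R k - H. T a k = {}}" 1] by simp
  define Ov where "Ov = {a. a < n \<and> a \<notin> H \<and> a \<notin> Z \<and> M < load a}"
  have "real (card Ov) * M \<le> M * real n / 8"
  proof -
    define f where "f = (\<lambda>a k. if a \<notin> H \<and> T a k \<noteq> {} then w (card (T a k)) else 0)"
    have "real (card Ov) * M = (\<Sum>a\<in>Ov. M)" by simp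
    also have "\<dots> \<le> (\<Sum>a\<in>Ov. \<Sum>k\<in>K a. f a k)"
    proof (rule sum_mono)
      fix a assume a: "a \<in> Ov"
      then have "load a = (\<Sum>k\<in>K a. f a k)"
        unfolding load_def f_def by (intro sum.cong) (auto simp: Ov_def Z_def K_iff)
      then show "M \<le> (\<Sum>k\<in>K a. f a k)" using a by (simp add: Ov_def)
    qed
    also have "\<dots> \<le> (\<Sum>a<n. \<Sum>k\<in>K a. f a k)"
      by (intro sum_mono2) (auto simp: Ov_def f_def w(1) intro!: sum_nonneg)
    also have "\<dots> = (\<Sum>k<D. \<Sum>a\<in>R k. f a k)" by (rule double)
    also have "\<dots> \<le> (\<Sum>k<D. \<Sum>t=1..L. w t)"
    proof (rule sum_mono)
      fix k assume "k \<in> {..<D}"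
      then have k: "k < D" by simp
      let ?R = "{a \<in> R k - H. T a k \<noteq> {}}"
      have "(\<Sum>a\<in>R k. f a k) = (\<Sum>a\<in>?R. w (card (T a k)))"
        unfolding f_def by (rule sum.mono_neutral_cong_right) auto
      also have "\<dots> = (\<Sum>t\<in>(\<lambda>a. card (T a k)) ` ?R. w t)"
        by (rule sum.reindex[symmetric, unfolded comp_def]) (rule inj_on_subset[OF injT[OF k]], auto)
      also have "\<dots> \<le> (\<Sum>t=1..L. w t)"
        using cardT w(1) by (intro sum_mono2) (auto simp: Suc_le_eq card_gt_0_iff)
      finally show "(\<Sum>a\<in>R k. f a k) \<le> (\<Sum>t=1..L. w t)" .
    qed
    also have "\<dots> \<le> M * real n / 8" using w(2) by simp
    finally show ?thesis .
  qed
  then have cardOv: "real (card Ov) \<le> real n / 8"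
    using w(3) by (simp add: field_simps)
  have finG [simp]: "finite G" by (simp add: G_def)
  have "{..<n} \<subseteq> G \<union> H \<union> Z \<union> Ov" by (auto simp: G_def Ov_def)
  moreover have "finite (G \<union> H \<union> Z \<union> Ov)"
    using H_lt finite_subset by (auto simp: Z_def Ov_def)
  ultimately have "n \<le> card (G \<union> H \<union> Z \<union> Ov)"
    using card_mono[of "G \<union> H \<union> Z \<union> Ov" "{..<n}"] by simp
  also have "\<dots> \<le> card G + card H + card Z + card Ov"
    by (intro order_trans[OF card_Un_le] add_mono card_Un_le order_refl)
  finally have "real n \<le> real (card G) + real (card H) + real (card Z) + real (card Ov)"
    by (simp flip: of_nat_add)
  moreover have "128 * real (card H) \<le> real n" "128 * real (card Z) \<le> real n"
    using D cardH cardZ by linarith+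
  ultimately have cardG: "real n / 2 \<le> real (card G)"
    using cardOv by linarith

  have U_notin_H: "x \<notin> H" if "a \<in> G" "x \<in> U a" for a x
    using that by (auto simp: U_def G_def T_def)
  have "\<exists>A\<subseteq>G. disjoint_family_on U A \<and> card G \<le> card A * (1 + L\<^sup>2)\<^sup>2"
  proof (rule disjoint_subfamily[OF finG], goal_cases)
    case (1 a)
    have "card (U a) \<le> 1 + card (\<Union>k\<in>K a. T a k)"
      unfolding U_def by (simp add: card_insert_if)
    also have "card (\<Union>k\<in>K a. T a k) \<le> card (K a) * L"
      using cardT by (intro card_UN_le_mult) auto
    also have "card (K a) \<le> L" using 1 by (simp add: G_def H_def)
    finally show ?case by (simp add: U_def power2_eq_square)
  next
    case (2 x)
    then have xH: "x \<notin> H" using U_notin_H by blast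
    \<comment> \<open>A predecessor of \<open>a\<close> in a ranking occurs in that ranking itself, hence within its first \<open>L\<close> entries.\<close>
    have "{a\<in>G. x \<in> U a} \<subseteq> insert x (\<Union>k\<in>K x. R k)"
    proof
      fix a assume "a \<in> {a\<in>G. x \<in> U a}"
      then consider "x = a" | k where "k \<in> K a" "x \<in> T a k" by (auto simp: U_def)
      then show "a \<in> insert x (\<Union>k\<in>K x. R k)"
      proof cases
        case (2 k)
        then have "k \<in> K x" "a \<in> R k" using T_sub by (auto simp: K_iff)
        then show ?thesis by blast
      qed simp
    qed
    then have "card {a\<in>G. x \<in> U a} \<le> card (insert x (\<Union>k\<in>K x. R k))"
      by (intro card_mono) auto
    also have "\<dots> \<le> 1 + card (\<Union>k\<in>K x. R k)"
      by (simp add: card_insert_if)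
    also have "card (\<Union>k\<in>K x. R k) \<le> card (K x) * L"
      using cardR by (intro card_UN_le_mult) auto
    also have "card (K x) \<le> L" using xH by (simp add: H_def)
    finally show ?case by (simp add: power2_eq_square)
  qed
  then obtain A where A: "A \<subseteq> G" "disjoint_family_on U A" and cardA: "card G \<le> card A * (1 + L\<^sup>2)\<^sup>2"
    by blast
  have "real (card G) \<le> real (card A * (1 + L\<^sup>2)\<^sup>2)"
    using cardA by (simp only: of_nat_le_iff)
  then have "real n / 2 \<le> real (card A) * (1 + real L ^ 2) ^ 2"
    using cardG by simp
  moreover have "U a \<subseteq> {..<n} \<and> a \<in> U a" if "a \<in> A" for a
    using that A T_sub R_lt by (fastforce simp: U_def G_def K_iff)
  moreover have "(\<Sum>k | k < D \<and> (\<exists>i<L. P (k, i) = a). w (card (T a k))) \<le> M" if "a \<in> A" for a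
    using that A(1) by (auto simp: G_def load_def K_def)
  moreover have "T a k \<noteq> {} \<and> T a k \<subseteq> U a - {a} \<and> T a k \<subseteq> {P (k, j) | j. j < i}"
    if "a \<in> A" "k < D" "i < L" "P (k, i) = a" for a k i
  proof (intro conjI)
    have kK: "k \<in> K a" and "a \<in> R k" using that by (auto simp: K_def R_def)
    then show "T a k \<noteq> {}" using A(1) that by (auto simp: G_def Z_def)
    show "T a k \<subseteq> {P (k, j) | j. j < i}" using T_eq[OF that(2-4)] by blast
    then have "a \<notin> T a k"
      using inj_onD[OF inj[OF that(2,3)]] that(3,4) by fastforce
    then show "T a k \<subseteq> U a - {a}" using kK by (auto simp: U_def)
  qed
  moreover have "A \<subseteq> {..<n}" using A(1) by (auto simp: G_def)
  ultimately show ?thesis using A(2) by (intro that[of A U T]) simp_all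
qed

section \<open>The probability of a fixed covering\<close>

text \<open>
  Expanding the logarithm and summing over \<open>t\<close> first leaves $\sum_j q^j/(j(1-q^j))$ with $q = 1-p$.
  Since $(1-p)^j(1+jp) \le 1$, each term is at most $1/(j^2p)$. It is essential that the bound does
  not grow with \<open>L\<close>.
\<close>

lemma sum_neg_ln_one_minus_power_le:
  fixes p :: real
  assumes p: "0 < p" "p < 1"
  shows "(\<Sum>t=1..L. - ln (1 - (1 - p) ^ t)) \<le> 3 / p"
proof -
  define q where "q = 1 - p"
  have q: "0 < q" "q < 1" using p by (auto simp: q_def)
  have geo: "(\<Sum>t=1..L. (q ^ j) ^ t) \<le> 1 / (real j * p)" if "0 < j" for j
  proof -
    define r where "r = q ^ j"
    have r: "0 < r" "r < 1" using q that by (auto simp: r_def power_less_one_iff)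
    have "(1 - r) * (\<Sum>t=1..L. r ^ t) = r - r ^ Suc L"
    proof (induction L)
      case (Suc L)
      have "(1 - r) * (\<Sum>t=1..Suc L. r ^ t) = (1 - r) * (\<Sum>t=1..L. r ^ t) + (1 - r) * r ^ Suc L"
        by (simp add: distrib_left)
      also have "\<dots> = r - r ^ Suc (Suc L)"
        unfolding Suc.IH by (simp add: algebra_simps)
      finally show ?case .
    qed simp
    then have "(1 - r) * (\<Sum>t=1..L. r ^ t) \<le> r" using r by simp
    then have "(\<Sum>t=1..L. r ^ t) \<le> r / (1 - r)" using r by (simp add: field_simps)
    also have "\<dots> \<le> 1 / (real j * p)"
    proof -
      have "r \<le> exp (- p) ^ j"
        unfolding r_def q_def using p exp_ge_add_one_self[of "- p"] by (intro power_mono) auto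
      then have "r \<le> exp (- (real j * p))" by (simp add: exp_of_nat_mult[symmetric])
      moreover have "1 + real j * p \<le> exp (real j * p)" by (rule exp_ge_add_one_self)
      ultimately have "r * (1 + real j * p) \<le> exp (- (real j * p)) * exp (real j * p)"
        using r p by (intro mult_mono) auto
      then have "r * (1 + real j * p) \<le> 1" by (simp add: exp_minus)
      then show ?thesis using r p that by (simp add: field_simps)
    qed
    finally show ?thesis by (simp add: r_def)
  qed
  have "(\<lambda>j. (q ^ t) ^ j / real j) sums - ln (1 - q ^ t)" if "t \<in> {1..L}" for t
  proof -
    have "\<bar>- (q ^ t)\<bar> < 1" using q that by (simp add: power_less_one_iff abs_of_nonneg)
    from sums_minus[OF ln_series'[OF this]] show ?thesis by simp
  qed
  then have 1: "(\<lambda>j. \<Sum>t=1..L. (q ^ t) ^ j / real j) sums (\<Sum>t=1..L. - ln (1 - q ^ t))"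
    by (rule sums_sum)
  have "(\<lambda>j. 1 / real (Suc j) ^ 2) sums (pi\<^sup>2 / 6)"
    using inverse_squares_sums by (simp add: add.commute)
  then have "(\<lambda>j. 1 / real j ^ 2) sums (pi\<^sup>2 / 6)"
    by (subst (asm) sums_Suc_iff) simp
  then have 2: "(\<lambda>j. 1 / p * (1 / real j ^ 2)) sums (1 / p * (pi\<^sup>2 / 6))"
    by (rule sums_mult)
  have "(\<Sum>t=1..L. - ln (1 - q ^ t)) \<le> 1 / p * (pi\<^sup>2 / 6)"
  proof (rule sums_le[OF _ 1 2])
    fix j
    show "(\<Sum>t=1..L. (q ^ t) ^ j / real j) \<le> 1 / p * (1 / real j ^ 2)"
    proof (cases "j = 0")
      case False
      have "(\<Sum>t=1..L. (q ^ t) ^ j / real j) = (\<Sum>t=1..L. (q ^ j) ^ t) / real j"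
        by (simp add: sum_divide_distrib power_mult[symmetric] mult.commute)
      also have "\<dots> \<le> 1 / (real j * p) / real j"
        using geo[of j] False by (intro divide_right_mono) auto
      finally show ?thesis by (simp add: power2_eq_square mult_ac)
    qed simp
  qed
  also have "\<dots> \<le> 1 / p * 3"
  proof -
    have "pi\<^sup>2 \<le> 4\<^sup>2" using pi_less_4 pi_gt_zero by (intro power_mono) auto
    then show ?thesis using p by (intro mult_left_mono) auto
  qed
  finally show ?thesis by (simp add: q_def)
qed

text \<open>
  The event that every non-edge \<open>(a, b)\<close> is explained by the rankings of the rows or by those of the
  columns: in some ranking that contains \<open>a\<close>, neither \<open>a\<close> nor its predecessors are adjacent to \<open>b\<close>,
  or the same with the roles exchanged. That the pair itself is a non-edge is part of the premise.
\<close>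

definition covering :: "nat \<Rightarrow> nat \<Rightarrow> nat \<Rightarrow> (nat \<times> nat \<Rightarrow> nat) \<Rightarrow> (nat \<times> nat \<Rightarrow> nat) \<Rightarrow> (nat \<times> nat \<Rightarrow> bool) set" where
  "covering n D L P Q = {X. \<forall>a<n. \<forall>b<n. \<not> X (a, b) \<longrightarrow>
     (\<exists>k<D. \<exists>i<L. P (k, i) = a \<and> (\<forall>j<i. \<not> X (P (k, j), b))) \<or>
     (\<exists>k<D. \<exists>i<L. Q (k, i) = b \<and> (\<forall>j<i. \<not> X (a, Q (k, j))))}"

text \<open>
  The sets may overlap, so the events are not independent, but they are all up-closed.
\<close>

lemma prob_all_hit_ge:
  fixes T :: "'k \<Rightarrow> 'a set" and M p :: real
  assumes A: "finite A" "\<And>k. k \<in> K \<Longrightarrow> T k \<subseteq> A \<and> T k \<noteq> {}"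
    and K: "finite K" and p: "0 < p" "p < 1"
    and load: "(\<Sum>k\<in>K. - ln (1 - (1 - p) ^ card (T k))) \<le> M"
  shows "exp (- M) \<le> measure_pmf.prob (coins A p) (\<Inter>k\<in>K. {X. \<exists>x\<in>T k. X x})"
proof -
  have pos: "0 < 1 - (1 - p) ^ card (T k)" if "k \<in> K" for k
  proof -
    have "card (T k) > 0" using A that finite_subset by (fastforce simp: card_gt_0_iff)
    then show ?thesis using p by (simp add: power_less_one_iff)
  qed
  have "exp (- M) \<le> exp (\<Sum>k\<in>K. ln (1 - (1 - p) ^ card (T k)))"
    using load by (simp add: sum_negf)
  also have "\<dots> = (\<Prod>k\<in>K. 1 - (1 - p) ^ card (T k))"
    using pos by (simp add: exp_sum[OF K])
  also have "\<dots> = (\<Prod>k\<in>K. measure_pmf.prob (coins A p) {X. \<exists>x\<in>T k. X x})"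
    using A p by (intro prod.cong refl prob_coins_hit[symmetric]) auto
  also have "\<dots> \<le> measure_pmf.prob (coins A p) (\<Inter>k\<in>K. {X. \<exists>x\<in>T k. X x})"
    using A K p by (intro harris_INT) (auto simp: up_closed_def le_fun_def)
  finally show ?thesis .
qed

text \<open>
  For selected rows \<open>a\<close> and columns \<open>b\<close>, the event \<open>E (a, b)\<close> that \<open>(a, b)\<close> is a non-edge that
  no ranking explains depends only on the pair itself and on pairs in $U_a \times \{b\}$ and
  $\{a\} \times V_b$. These lie in $U_a \times V_b$, so different selected pairs use disjoint sets of
  coins. Writing $\delta$ for the lower bound on the probability of each event and $m$ for the one on
  the numbers of selected rows and columns, the probability that none occurs is at most
  $(1-\delta)^{m^2} \le e^{-\delta m^2}$.
\<close>

lemma prob_covering_le: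
  fixes P Q :: "nat \<times> nat \<Rightarrow> nat" and p :: real
  assumes D: "128 * D \<le> n" and p: "0 < p" "p \<le> 1 / 2"
    and P: "rankings n D L P"
    and Q: "rankings n D L Q"
  shows "measure_pmf.prob (coins ({..<n} \<times> {..<n}) p) (covering n D L P Q) \<le>
     exp (- (exp (- 1 / (2 * p)) / 2 * (real n / (2 * (1 + real L ^ 2) ^ 2)) ^ 2))"
proof -
  define C where "C = {..<n} \<times> {..<n}"
  define w where "w = (\<lambda>t. - ln (1 - (1 - p) ^ t))"
  define \<delta> where "\<delta> = exp (- 1 / (2 * p)) / 2"
  define m where "m = real n / (2 * (1 + real L ^ 2) ^ 2)"
  have finC: "finite C" by (simp add: C_def)
  have p': "0 \<le> p" "p \<le> 1" "p < 1" using p by auto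
  have w_nonneg: "0 \<le> w t" for t
  proof (cases "t = 0")
    case False
    then have "(1 - p) ^ t < 1" "0 \<le> (1 - p) ^ t" using p by (simp_all add: power_less_one_iff)
    then show ?thesis by (simp add: w_def)
  qed (simp add: w_def)
  \<comment> \<open>The weight of a selected row is thus at most $1/(4p)$, which is $(\ln n)/4$ for $p = 1/\ln n$.\<close>
  have "real D * (\<Sum>t=1..L. w t) \<le> real n / 128 * (3 / p)"
    using D sum_neg_ln_one_minus_power_le[OF p(1) p'(3)] w_nonneg
    by (intro mult_mono) (auto simp: w_def sum_nonneg)
  also have "\<dots> \<le> 1 / (4 * p) * real n / 8" using p by (simp add: field_simps)
  finally have w_sum: "real D * (\<Sum>t=1..L. w t) \<le> 1 / (4 * p) * real n / 8" .
  have M: "0 < 1 / (4 * p)" using p by simp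
  obtain A U T where A: "A \<subseteq> {..<n}" "disjoint_family_on U A"
    "real n / 2 \<le> real (card A) * (1 + real L ^ 2) ^ 2"
    and U': "\<forall>a\<in>A. U a \<subseteq> {..<n} \<and> a \<in> U a"
    and A_load': "\<forall>a\<in>A. (\<Sum>k | k < D \<and> (\<exists>i<L. P (k, i) = a). w (card (T a k))) \<le> 1 / (4 * p)"
    and T': "\<forall>a\<in>A. \<forall>k<D. \<forall>i<L. P (k, i) = a \<longrightarrow>
      T a k \<noteq> {} \<and> T a k \<subseteq> U a - {a} \<and> T a k \<subseteq> {P (k, j) | j. j < i}"
    by (rule disjoint_light_rows[where w = w, OF D P w_nonneg w_sum M])
  note U = U'[rule_format] and A_load = A_load'[rule_format] and T = T'[rule_format]
  obtain B V S where B: "B \<subseteq> {..<n}" "disjoint_family_on V B"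
    "real n / 2 \<le> real (card B) * (1 + real L ^ 2) ^ 2"
    and V': "\<forall>b\<in>B. V b \<subseteq> {..<n} \<and> b \<in> V b"
    and B_load': "\<forall>b\<in>B. (\<Sum>k | k < D \<and> (\<exists>i<L. Q (k, i) = b). w (card (S b k))) \<le> 1 / (4 * p)"
    and S': "\<forall>b\<in>B. \<forall>k<D. \<forall>i<L. Q (k, i) = b \<longrightarrow>
      S b k \<noteq> {} \<and> S b k \<subseteq> V b - {b} \<and> S b k \<subseteq> {Q (k, j) | j. j < i}"
    by (rule disjoint_light_rows[where w = w, OF D Q w_nonneg w_sum M])
  note V = V'[rule_format] and B_load = B_load'[rule_format] and S = S'[rule_format]
  define KA where "KA = (\<lambda>a. {k. k < D \<and> (\<exists>i<L. P (k, i) = a)})"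
  define KB where "KB = (\<lambda>b. {k. k < D \<and> (\<exists>i<L. Q (k, i) = b)})"
  define RH where "RH = (\<lambda>(a::nat) (b::nat). \<Inter>k\<in>KA a. {X. \<exists>x\<in>T a k \<times> {b}. X x})"
  define CH where "CH = (\<lambda>(a::nat) (b::nat). \<Inter>k\<in>KB b. {X. \<exists>x\<in>{a} \<times> S b k. X x})"
  define E where "E = (\<lambda>(a, b). {X. \<not> X (a, b)} \<inter> (RH a b \<inter> CH a b))"
  define W where "W = (\<lambda>(a, b). (U a - {a}) \<times> {b} \<union> {a} \<times> (V b - {b}))"

  have disjoint: "disjoint_family_on (\<lambda>c. insert c (W c)) (A \<times> B)"
  proof -
    have "insert (a, b) (W (a, b)) \<subseteq> U a \<times> V b" if "a \<in> A" "b \<in> B" for a b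
      using U[OF that(1)] V[OF that(2)] by (auto simp: W_def)
    moreover have "(U a \<times> V b) \<inter> (U a' \<times> V b') = {}"
      if "a \<in> A" "b \<in> B" "a' \<in> A" "b' \<in> B" "(a, b) \<noteq> (a', b')" for a b a' b'
      using that disjoint_family_onD[OF A(2), of a a'] disjoint_family_onD[OF B(2), of b b'] by blast
    ultimately show ?thesis
      unfolding disjoint_family_on_def by (smt (verit, best) SigmaE disjoint_iff subset_iff)
  qed
  have det_hits: "determined_by (W (a, b)) (RH a b \<inter> CH a b)" if "a \<in> A" "b \<in> B" for a b
  proof (intro determined_by_Int)
    have "T a k \<times> {b} \<subseteq> W (a, b)" if "k \<in> KA a" for k
      using T[OF \<open>a \<in> A\<close>] that by (fastforce simp: KA_def W_def)
    then show "determined_by (W (a, b)) (RH a b)"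
      unfolding RH_def by (intro determined_by_INT) (fastforce simp: determined_by_def)
    have "{a} \<times> S b k \<subseteq> W (a, b)" if "k \<in> KB b" for k
      using S[OF \<open>b \<in> B\<close>] that by (fastforce simp: KB_def W_def)
    then show "determined_by (W (a, b)) (CH a b)"
      unfolding CH_def by (intro determined_by_INT) (fastforce simp: determined_by_def)
  qed
  have det_single: "determined_by {c} {X. \<not> X c}" for c :: "nat \<times> nat"
    by (simp add: determined_by_def)
  have prob_E: "\<delta> \<le> measure_pmf.prob (coins C p) (E c)" if AB: "c \<in> A \<times> B" for c
  proof -
    obtain a b where c: "c = (a, b)" "a \<in> A" "b \<in> B" using AB by blast
    have lt: "a < n" "b < n" using c A(1) B(1) by auto
    have "exp (- (1 / (4 * p))) \<le> measure_pmf.prob (coins C p) (RH a b)"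
      unfolding RH_def
    proof (rule prob_all_hit_ge[OF finC _ _ p(1) p'(3)])
      show "T a k \<times> {b} \<subseteq> C \<and> T a k \<times> {b} \<noteq> {}" if "k \<in> KA a" for k
        using T[OF c(2)] U[OF c(2)] that lt(2) by (fastforce simp: KA_def C_def)
    qed (use A_load[OF c(2)] in \<open>auto simp: KA_def w_def card_cartesian_product\<close>)
    moreover have "exp (- (1 / (4 * p))) \<le> measure_pmf.prob (coins C p) (CH a b)"
      unfolding CH_def
    proof (rule prob_all_hit_ge[OF finC _ _ p(1) p'(3)])
      show "{a} \<times> S b k \<subseteq> C \<and> {a} \<times> S b k \<noteq> {}" if "k \<in> KB b" for k
        using S[OF c(3)] V[OF c(3)] that lt(1) by (fastforce simp: KB_def C_def)
    qed (use B_load[OF c(3)] in \<open>auto simp: KB_def w_def card_cartesian_product\<close>)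
    ultimately have "exp (- (1 / (4 * p))) * exp (- (1 / (4 * p))) \<le>
        measure_pmf.prob (coins C p) (RH a b) * measure_pmf.prob (coins C p) (CH a b)"
      by (intro mult_mono) auto
    also have "\<dots> \<le> measure_pmf.prob (coins C p) (RH a b \<inter> CH a b)"
      unfolding RH_def CH_def using finC p'
      by (intro harris up_closed_INT) (auto simp: up_closed_def le_fun_def)
    finally have "1 / 2 * exp (- 1 / (2 * p)) \<le> (1 - p) * measure_pmf.prob (coins C p) (RH a b \<inter> CH a b)"
      using p by (intro mult_mono) (auto simp: exp_add[symmetric] field_simps)
    also have "1 - p = measure_pmf.prob (coins C p) {X. \<not> X c}"
      using prob_coins_all_False[OF finC p'(1,2), of "{c}"] lt by (simp add: c C_def)
    also have "measure_pmf.prob (coins C p) {X. \<not> X c} * measure_pmf.prob (coins C p) (RH a b \<inter> CH a b) =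
        measure_pmf.prob (coins C p) ({X. \<not> X c} \<inter> (RH a b \<inter> CH a b))"
      using prob_coins_indep[OF finC p'(1,2) det_single det_hits[OF c(2,3)], of c]
      by (simp add: c W_def)
    finally show ?thesis by (simp add: E_def c \<delta>_def)
  qed
  have "covering n D L P Q \<subseteq> (\<Inter>c\<in>A \<times> B. - E c)"
  proof (safe, rule ccontr)
    fix X a b assume X: "X \<in> covering n D L P Q" and ab: "a \<in> A" "b \<in> B" and "X \<in> E (a, b)"
    then have "\<not> X (a, b)" and hits: "X \<in> RH a b" "X \<in> CH a b"
      by (auto simp: E_def)
    moreover have "a < n" "b < n" using ab A(1) B(1) by auto
    ultimately consider 
        k i where "k < D" "i < L" "P (k, i) = a" "\<forall>j<i. \<not> X (P (k, j), b)"
      | k i where "k < D" "i < L" "Q (k, i) = b" "\<forall>j<i. \<not> X (a, Q (k, j))"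
      using X unfolding covering_def by blast
    then show False
    proof cases
      case (1 k i)
      then obtain x where "x \<in> T a k" "X (x, b)" using hits by (auto simp: RH_def KA_def)
      then show False using 1 T[OF ab(1) 1(1-3)] by auto
    next
      case (2 k i)
      then obtain y where "y \<in> S b k" "X (a, y)" using hits by (auto simp: CH_def KB_def)
      then show False using 2 S[OF ab(2) 2(1-3)] by auto
    qed
  qed
  then have "measure_pmf.prob (coins C p) (covering n D L P Q) \<le>
      measure_pmf.prob (coins C p) (\<Inter>c\<in>A \<times> B. - E c)"
    by (intro measure_pmf.finite_measure_mono) auto
  also have "\<dots> = (\<Prod>c\<in>A \<times> B. 1 - measure_pmf.prob (coins C p) (E c))"
  proof (rule prob_coins_none[OF finC p'(1,2) _ _ disjoint])
    show "finite (A \<times> B)" using A(1) B(1) finite_subset by blast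
    fix c assume "c \<in> A \<times> B"
    then obtain a b where c: "c = (a, b)" "a \<in> A" "b \<in> B" by blast
    have "determined_by (insert c (W c)) ({X. \<not> X c} \<inter> (RH a b \<inter> CH a b))"
      using determined_by_mono[OF det_single[of c], of "insert c (W c)"]
        determined_by_mono[OF det_hits[OF c(2,3)], of "insert c (W c)"]
      by (intro determined_by_Int[of _ "{X. \<not> X c}"]) (auto simp: c(1))
    then show "determined_by (insert c (W c)) (E c)" by (simp add: E_def c(1))
  qed
  also have "\<dots> \<le> (\<Prod>c\<in>A \<times> B. exp (- \<delta>))"
  proof (intro prod_mono conjI)
    fix c assume c: "c \<in> A \<times> B"
    show "0 \<le> 1 - measure_pmf.prob (coins C p) (E c)" by simp
    show "1 - measure_pmf.prob (coins C p) (E c) \<le> exp (- \<delta>)"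
      using prob_E[OF c] exp_ge_add_one_self[of "- \<delta>"] by linarith
  qed
  also have "\<dots> = exp (- (\<delta> * (real (card A) * real (card B))))"
    by (simp add: exp_of_nat_mult[symmetric] card_cartesian_product mult_ac)
  also have "\<dots> \<le> exp (- (\<delta> * m\<^sup>2))"
  proof -
    have pos: "0 < (1 + real L ^ 2) ^ 2"
      by (intro zero_less_power add_pos_nonneg) auto
    have "m \<le> real (card A)" "m \<le> real (card B)"
      using A(3) B(3) pos by (auto simp: m_def divide_le_eq mult.commute)
    moreover have "0 \<le> m" by (simp add: m_def)
    ultimately have "m\<^sup>2 \<le> real (card A) * real (card B)"
      unfolding power2_eq_square by (intro mult_mono) auto
    then show ?thesis by (simp add: \<delta>_def)
  qed
  finally show ?thesis by (simp add: C_def \<delta>_def m_def)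
qed

section \<open>From boxes to coverings\<close>

definition empty_square :: "nat \<Rightarrow> nat \<Rightarrow> (nat \<times> nat \<Rightarrow> bool) set" where
  "empty_square n L = {X. \<exists>A B. A \<subseteq> {..<n} \<and> B \<subseteq> {..<n} \<and> card A = L \<and> card B = L \<and>
     (\<forall>x\<in>A \<times> B. \<not> X x)}"

lemma prob_empty_square_le:
  assumes "0 \<le> p" "p \<le> 1" "L \<le> n"
  shows "measure_pmf.prob (coins ({..<n} \<times> {..<n}) p) (empty_square n L) \<le>
           real n ^ (2 * L) * (1 - p) ^ (L * L)"
proof -
  define C where "C = {..<n} \<times> {..<n}"
  define F where "F = {A. A \<subseteq> {..<n} \<and> card A = L}"
  have finF: "finite F" by (simp add: F_def)
  have "card F \<le> n ^ L"
    using n_subsets[of "{..<n}" L] binomial_le_pow[OF assms(3)] by (simp add: F_def)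
  then have cardF: "real (card (F \<times> F)) \<le> real n ^ (2 * L)"
    by (simp add: card_cartesian_product mult_2 power_add mult_mono flip: of_nat_power)
  have "empty_square n L = (\<Union>(A, B)\<in>F \<times> F. {X. \<forall>x\<in>A \<times> B. \<not> X x})"
    by (auto simp: empty_square_def F_def)
  then have "measure_pmf.prob (coins C p) (empty_square n L) \<le>
      (\<Sum>(A, B)\<in>F \<times> F. measure_pmf.prob (coins C p) {X. \<forall>x\<in>A \<times> B. \<not> X x})"
    using measure_UNION_le[of "F \<times> F" "\<lambda>(A, B). {X. \<forall>x\<in>A \<times> B. \<not> X x}" "measure_pmf (coins C p)"] finF
    by (simp add: case_prod_unfold)
  also have "\<dots> \<le> (\<Sum>AB\<in>F \<times> F. (1 - p) ^ (L * L))"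
  proof (rule sum_mono)
    fix AB assume "AB \<in> F \<times> F"
    then obtain A B where AB: "AB = (A, B)" "A \<in> F" "B \<in> F" by blast
    then have "A \<times> B \<subseteq> C" by (auto simp: F_def C_def)
    then show "(case AB of (A, B) \<Rightarrow> measure_pmf.prob (coins C p) {X. \<forall>x\<in>A \<times> B. \<not> X x}) \<le> (1 - p) ^ (L * L)"
      using AB prob_coins_all_False[of C p "A \<times> B"] assms
      by (simp add: C_def F_def card_cartesian_product)
  qed
  also have "\<dots> \<le> real n ^ (2 * L) * (1 - p) ^ (L * L)"
    using cardF assms by (simp add: mult_right_mono)
  finally show ?thesis by (simp add: C_def)
qed

lemma box_Int_nonempty_iff:
  fixes x y x' y' :: "nat \<Rightarrow> real"
  assumes "\<forall>i<d. x i \<le> y i" "\<forall>i<d. x' i \<le> y' i"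
  shows "(\<Pi>\<^sub>E i\<in>{..<d}. {x i..y i}) \<inter> (\<Pi>\<^sub>E i\<in>{..<d}. {x' i..y' i}) \<noteq> {} \<longleftrightarrow>
           (\<forall>i<d. x i \<le> y' i \<and> x' i \<le> y i)"
proof -
  have "{x i..y i} \<inter> {x' i..y' i} \<noteq> {} \<longleftrightarrow> x i \<le> y' i \<and> x' i \<le> y i" if "i < d" for i
    using assms that by (auto simp: Int_atLeastAtMost)
  then show ?thesis by (auto simp: PiE_Int PiE_eq_empty_iff)
qed

text \<open>
  Sort the rows by increasing \<open>f k\<close> and the columns by decreasing \<open>g k\<close>. If the relation \<open>k\<close>
  contains the pair at positions \<open>i\<close> and \<open>j\<close>, then all pairs at positions up to \<open>i\<close> and \<open>j\<close> are
  non-edges, and in the absence of an empty square \<open>i\<close> or \<open>j\<close> is less than \<open>L\<close>.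
\<close>

lemma covering_of_threshold_cover:
  fixes f g :: "nat \<Rightarrow> nat \<Rightarrow> real"
  assumes empty: "\<And>k a b. k < D \<Longrightarrow> a < n \<Longrightarrow> b < n \<Longrightarrow> f k a < g k b \<Longrightarrow> \<not> X (a, b)"
    and cover: "\<And>a b. a < n \<Longrightarrow> b < n \<Longrightarrow> \<not> X (a, b) \<Longrightarrow> \<exists>k<D. f k a < g k b"
    and L: "L \<le> n" and X: "X \<notin> empty_square n L"
  shows "\<exists>P Q. P \<in> {..<D} \<times> {..<L} \<rightarrow>\<^sub>E {..<n} \<and> Q \<in> {..<D} \<times> {..<L} \<rightarrow>\<^sub>E {..<n} \<and>
    rankings n D L P \<and> rankings n D L Q \<and> X \<in> covering n D L P Q"
proof -
  define p where "p = (\<lambda>k. sort_key (f k) [0..<n])"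
  define q where "q = (\<lambda>k. sort_key (\<lambda>b. - g k b) [0..<n])"
  define P where "P = (\<lambda>(k, i)\<in>{..<D} \<times> {..<L}. p k ! i)"
  define Q where "Q = (\<lambda>(k, i)\<in>{..<D} \<times> {..<L}. q k ! i)"
  have len: "length (p k) = n" "length (q k) = n" and dist: "distinct (p k)" "distinct (q k)"
    and set: "set (p k) = {..<n}" "set (q k) = {..<n}" for k
    by (auto simp: p_def q_def)
  have lt: "p k ! i < n" "q k ! i < n" if "i < n" for k i
    using nth_mem[of i "p k"] nth_mem[of i "q k"] that by (auto simp: len set)
  have f_mono: "f k (p k ! i) \<le> f k (p k ! j)" and g_mono: "g k (q k ! j) \<le> g k (q k ! i)"
    if "i \<le> j" "j < n" for i j k
    using sorted_nth_mono[of "map (f k) (p k)" i j] sorted_nth_mono[of "map (\<lambda>b. - g k b) (q k)" i j] that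
    by (simp_all add: len p_def q_def)
  have "P \<in> {..<D} \<times> {..<L} \<rightarrow>\<^sub>E {..<n}" "Q \<in> {..<D} \<times> {..<L} \<rightarrow>\<^sub>E {..<n}"
    using lt L by (auto simp: P_def Q_def)
  moreover have "rankings n D L P" "rankings n D L Q"
    using lt L dist len by (auto simp: rankings_def P_def Q_def inj_on_def nth_eq_iff_index_eq)
  moreover have "X \<in> covering n D L P Q"
    unfolding covering_def
  proof (intro CollectI allI impI)
    fix a b assume ab: "a < n" "b < n" "\<not> X (a, b)"
    then obtain k where k: "k < D" "f k a < g k b" using cover by blast
    obtain i where i: "i < n" "p k ! i = a"
      using ab(1) set(1)[of k] by (metis in_set_conv_nth len(1) lessThan_iff)
    obtain j where j: "j < n" "q k ! j = b"
      using ab(2) set(2)[of k] by (metis in_set_conv_nth len(2) lessThan_iff)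
    have rect: "\<not> X (p k ! i', q k ! j')" if "i' \<le> i" "j' \<le> j" for i' j'
      using that i j k lt f_mono[of i' i k] g_mono[of j' j k] by (intro empty[OF k(1)]) auto
    consider "i < L" | "j < L" | "L \<le> i" "L \<le> j" by linarith
    then show "(\<exists>k<D. \<exists>i<L. P (k, i) = a \<and> (\<forall>j<i. \<not> X (P (k, j), b))) \<or>
        (\<exists>k<D. \<exists>i<L. Q (k, i) = b \<and> (\<forall>j<i. \<not> X (a, Q (k, j))))"
    proof cases
      case 1
      have "P (k, i) = a" using 1 k i by (simp add: P_def)
      moreover have "\<not> X (P (k, i'), b)" if "i' < i" for i'
        using rect[of i' j] that 1 k j by (simp add: P_def)
      ultimately show ?thesis using 1 k by blast
    next
      case 2
      have "Q (k, j) = b" using 2 k j by (simp add: Q_def)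
      moreover have "\<not> X (a, Q (k, j'))" if "j' < j" for j'
        using rect[of i j'] that 2 k i by (simp add: Q_def)
      ultimately show ?thesis using 2 k by blast
    next
      case 3
      let ?A = "set (take L (p k))" and ?B = "set (take L (q k))"
      have "?A \<subseteq> {..<n}" "?B \<subseteq> {..<n}"
        using set_take_subset[of L "p k"] set_take_subset[of L "q k"] by (simp_all add: set)
      moreover have "card ?A = L" "card ?B = L"
        using L dist len by (simp_all add: distinct_card)
      moreover have "\<forall>x\<in>?A \<times> ?B. \<not> X x"
        using rect 3 by (fastforce simp: in_set_conv_nth)
      ultimately show ?thesis using X unfolding empty_square_def by blast
    qed
  qed
  ultimately show ?thesis by blast
qed

text \<open>
  Coordinate \<open>i\<close> contributes two relations: with index \<open>2 * i\<close> that the interval of the row lies to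
  the left of that of the column, with index \<open>2 * i + 1\<close> that it lies to the right, where the signs
  are reversed to bring it into the form \<open>f k a < g k b\<close>. The remaining indices get the empty
  relation $0 < 0$.
\<close>

lemma covering_of_box_representation:
  assumes B: "box_representation d (bipartite_graph_of n X) B" and d: "2 * d \<le> D"
    and L: "L \<le> n" and X: "X \<notin> empty_square n L"
  shows "\<exists>P Q. P \<in> {..<D} \<times> {..<L} \<rightarrow>\<^sub>E {..<n} \<and> Q \<in> {..<D} \<times> {..<L} \<rightarrow>\<^sub>E {..<n} \<and>
    rankings n D L P \<and> rankings n D L Q \<and> X \<in> covering n D L P Q"
proof -
  let ?G = "bipartite_graph_of n X"
  have "\<forall>v\<in>verts ?G. \<exists>x y. (\<forall>i<d. x i \<le> y i) \<and> B v = (\<Pi>\<^sub>E i\<in>{..<d}. {x i..y i})"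
    using B by (simp add: box_representation_def is_box_def)
  then obtain x y where xy: "\<And>v. v \<in> verts ?G \<Longrightarrow> \<forall>i<d. x v i \<le> y v i"
    and B_eq: "\<And>v. v \<in> verts ?G \<Longrightarrow> B v = (\<Pi>\<^sub>E i\<in>{..<d}. {x v i..y v i})"
    by metis
  have meet: "X (a, b) \<longleftrightarrow> (\<forall>i<d. x (Inl a) i \<le> y (Inr b) i \<and> x (Inr b) i \<le> y (Inl a) i)"
    if "a < n" "b < n" for a b
  proof -
    have v: "Inl a \<in> verts ?G" "Inr b \<in> verts ?G"
      using that by (auto simp: bipartite_graph_of_def)
    have "X (a, b) \<longleftrightarrow> {Inl a, Inr b} \<in> edges ?G"
      using that by (auto simp: bipartite_graph_of_def doubleton_eq_iff)
    also have "\<dots> \<longleftrightarrow> B (Inl a) \<inter> B (Inr b) \<noteq> {}"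
      using B v unfolding box_representation_def by blast
    finally show ?thesis
      using box_Int_nonempty_iff[OF xy[OF v(1)] xy[OF v(2)]] by (simp add: B_eq v)
  qed
  define f where "f = (\<lambda>k a. if k < 2 * d then if even k then y (Inl a) (k div 2) else - x (Inl a) (k div 2) else 0)"
  define g where "g = (\<lambda>k b. if k < 2 * d then if even k then x (Inr b) (k div 2) else - y (Inr b) (k div 2) else 0)"
  show ?thesis
  proof (rule covering_of_threshold_cover[where f = f and g = g, OF _ _ L X])
    fix k a b assume "a < n" "b < n" "f k a < g k b"
    then show "\<not> X (a, b)"
      by (auto simp: meet f_def g_def not_le intro!: exI[of _ "k div 2"] split: if_splits)
  next
    fix a b assume "a < n" "b < n" "\<not> X (a, b)"
    then obtain i where "i < d" "y (Inr b) i < x (Inl a) i \<or> y (Inl a) i < x (Inr b) i"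
      by (auto simp: meet not_le)
    then have "f (2 * i + 1) a < g (2 * i + 1) b \<or> f (2 * i) a < g (2 * i) b" "2 * i + 1 < D"
      using d by (auto simp: f_def g_def)
    then show "\<exists>k<D. f k a < g k b"
      by (metis add_lessD1)
  qed
qed

section \<open>The lower bound on the boxicity\<close>

text \<open>
  The three summands bound the probabilities of too many edges, of an empty square, and of a
  covering. In the last one, the number of rankings contributes $e^{4nl^3}$, which is outweighed by the exponent
  $n^{3/2}$ divided by a power of $l$.
\<close>

lemma bound_tendsto_0:
  "(\<lambda>n::nat. exp (- (real n ^ 2 / ln (real n))) + 1 / real n +
      exp (4 * real n * ln (real n) ^ 3 - real n powr (3 / 2) / (8 * (1 + 16 * ln (real n) ^ 4) ^ 4)))
     \<longlonglongrightarrow> 0"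
  by real_asymp

lemma prob_small_boxicity_le:
  fixes n :: nat
  defines "l \<equiv> ln (real n)"
  assumes l: "2 \<le> l" and small: "4 * l ^ 2 \<le> real n"
  shows "measure_pmf.prob (coins ({..<n} \<times> {..<n}) (1 / l))
      {X. \<not> 1 / 512 * sqrt (real (card (edges (bipartite_graph_of n X))) * l / 2)
            \<le> real (boxicity (bipartite_graph_of n X))} \<le>
    exp (- (real n ^ 2 / l)) + 1 / real n +
      exp (4 * real n * l ^ 3 - real n powr (3 / 2) / (8 * (1 + 16 * l ^ 4) ^ 4))"
proof -
  define C where "C = {..<n} \<times> {..<n}"
  define p where "p = 1 / l"
  define L where "L = nat \<lceil>3 * l ^ 2\<rceil>"
  define D where "D = n div 128"
  let ?G = "bipartite_graph_of n"
  let ?prob = "measure_pmf.prob (coins C p)"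
  have p: "0 < p" "p \<le> 1 / 2" "0 \<le> p" "p \<le> 1" using l by (auto simp: p_def field_simps)
  have "0 < n" using l by (cases "n = 0") (auto simp: l_def)
  then have n: "0 < n" "real n = exp l" by (simp_all add: l_def)
  have cardC: "card C = n * n" and finC: "finite C" by (simp_all add: C_def)
  have l2: "2 * 2 \<le> l ^ 2" unfolding power2_eq_square using l by (intro mult_mono) auto
  have L: "3 * l ^ 2 \<le> real L" "real L \<le> 4 * l ^ 2" "1 \<le> L"
  proof -
    show *: "3 * l ^ 2 \<le> real L" unfolding L_def by linarith
    show "real L \<le> 4 * l ^ 2" using l2 unfolding L_def by linarith
    show "1 \<le> L" using * l2 by (cases L) auto
  qed
  have "L \<le> n" using L(2) small by linarith
  have D: "128 * D \<le> n" by (simp add: D_def)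

  define \<R> where "\<R> = {P \<in> {..<D} \<times> {..<L} \<rightarrow>\<^sub>E {..<n}. rankings n D L P}"
  define many where "many = {X. 3 * p * real (card C) \<le> real (card {x\<in>C. X x})}"
  define covered where "covered = (\<Union>(P, Q)\<in>\<R> \<times> \<R>. covering n D L P Q)"
  have fin\<R>: "finite \<R>"
    unfolding \<R>_def by (rule finite_subset[OF _ finite_PiE[of "{..<D} \<times> {..<L}" "\<lambda>_. {..<n}"]]) auto
  have card\<R>: "real (card \<R>) \<le> real n ^ (D * L)"
  proof -
    have "card \<R> \<le> card ({..<D} \<times> {..<L} \<rightarrow>\<^sub>E {..<n})"
      unfolding \<R>_def by (intro card_mono finite_PiE) auto
    then show ?thesis by (simp add: card_funcsetE flip: of_nat_power)
  qed

  have "{X. \<not> 1 / 512 * sqrt (real (card (edges (?G X))) * l / 2) \<le> real (boxicity (?G X))}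
      \<subseteq> many \<union> empty_square n L \<union> covered"
  proof (rule subsetI, rule ccontr)
    fix X
    assume "X \<in> {X. \<not> 1 / 512 * sqrt (real (card (edges (?G X))) * l / 2) \<le> real (boxicity (?G X))}"
      and notin: "X \<notin> many \<union> empty_square n L \<union> covered"
    then have small_box: "real (boxicity (?G X)) < 1 / 512 * sqrt (real (card (edges (?G X))) * l / 2)"
      by simp
    have "edges (?G X) = (\<lambda>(i, j). {Inl i, Inr j}) ` {x\<in>C. X x}"
      by (auto simp: bipartite_graph_of_def C_def)
    then have "real (card (edges (?G X))) \<le> real (card {x\<in>C. X x})"
      using finC by (simp add: card_image_le)
    also have "real (card {x\<in>C. X x}) < 3 * p * real (card C)"
      using notin by (simp add: many_def)
    finally have "real (card (edges (?G X))) < 3 * p * real (card C)" .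
    then have "real (card (edges (?G X))) * l / 2 \<le> 3 / 2 * real n ^ 2"
      using l by (simp add: p_def cardC power2_eq_square field_simps)
    also have "\<dots> \<le> (2 * real n) ^ 2" by (simp add: power2_eq_square)
    finally have "sqrt (real (card (edges (?G X))) * l / 2) \<le> 2 * real n"
      by (intro real_le_lsqrt) auto
    \<comment> \<open>The constant $1/512$ makes the $2d$ relations of a representation fit into \<open>D = n div 128\<close>.\<close>
    with small_box have "256 * real (boxicity (?G X)) < real n" by linarith
    then have "256 * boxicity (?G X) < n" by linarith
    then have d: "2 * boxicity (?G X) \<le> D"
      by (simp add: D_def less_eq_div_iff_mult_less_eq)
    have "finite_simple_graph (?G X)"
      by (auto simp: bipartite_graph_of_def finite_simple_graph_def)
    from LeastI_ex[OF box_representation_exists[OF this]]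
    obtain B where "box_representation (boxicity (?G X)) (?G X) B"
      unfolding boxicity_def by blast
    from covering_of_box_representation[OF this d \<open>L \<le> n\<close>] show False
      using notin by (auto simp: covered_def \<R>_def)
  qed
  then have "?prob {X. \<not> 1 / 512 * sqrt (real (card (edges (?G X))) * l / 2) \<le> real (boxicity (?G X))}
      \<le> ?prob (many \<union> empty_square n L \<union> covered)"
    by (intro measure_pmf.finite_measure_mono) auto
  also have "\<dots> \<le> ?prob many + ?prob (empty_square n L) + ?prob covered"
    by (intro order_trans[OF measure_subadditive] add_mono measure_subadditive order_refl) 
      (auto simp: measure_pmf.emeasure_eq_measure)
  also have "?prob many \<le> exp (- (real n ^ 2 / l))"
    using prob_coins_many[OF finC p(3,4)] by (simp add: many_def cardC p_def power2_eq_square)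
  also have "?prob (empty_square n L) \<le> 1 / real n"
  proof -
    have "?prob (empty_square n L) \<le> real n ^ (2 * L) * (1 - p) ^ (L * L)"
      unfolding C_def by (rule prob_empty_square_le[OF p(3,4) \<open>L \<le> n\<close>])
    also have "\<dots> \<le> exp l ^ (2 * L) * exp (- p) ^ (L * L)"
      unfolding n(2) using p exp_ge_add_one_self[of "- p"] by (intro mult_left_mono power_mono) auto
    also have "\<dots> = exp (real L * (2 * l - p * real L))"
      by (simp add: exp_of_nat_mult[symmetric] exp_add[symmetric] algebra_simps)
    also have "\<dots> \<le> exp (- l)"
    proof -
      \<comment> \<open>The choice of the two sides costs $e^{2lL}$ and the empty square gains $e^{-L^2/l}$.\<close>
      have "p * (3 * l ^ 2) \<le> p * real L" using L(1) p by (intro mult_left_mono) auto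
      then have "3 * l \<le> p * real L" using l by (simp add: p_def power2_eq_square)
      then have "2 * l - p * real L \<le> - l" by simp
      then have "real L * (2 * l - p * real L) \<le> real L * (- l)" by (intro mult_left_mono) auto
      also have "\<dots> \<le> 1 * (- l)" using L(3) l by (intro mult_right_mono_neg) auto
      finally show ?thesis by simp
    qed
    also have "\<dots> = 1 / real n" by (simp add: n(2) exp_minus field_simps)
    finally show ?thesis .
  qed
  also have "?prob covered \<le> exp (4 * real n * l ^ 3 - real n powr (3 / 2) / (8 * (1 + 16 * l ^ 4) ^ 4))"
  proof -
    define E where "E = exp (- 1 / (2 * p)) / 2 * (real n / (2 * (1 + real L ^ 2) ^ 2)) ^ 2"
    have "?prob covered \<le> (\<Sum>(P, Q)\<in>\<R> \<times> \<R>. ?prob (covering n D L P Q))"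
      using measure_UNION_le[of "\<R> \<times> \<R>" "\<lambda>(P, Q). covering n D L P Q" "measure_pmf (coins C p)"] fin\<R>
      by (simp add: covered_def case_prod_unfold)
    also have "\<dots> \<le> (\<Sum>PQ\<in>\<R> \<times> \<R>. exp (- E))"
      unfolding E_def C_def
      by (intro sum_mono) (auto simp: \<R>_def intro!: prob_covering_le[OF D p(1,2), simplified])
    also have "\<dots> = real (card \<R>) * real (card \<R>) * exp (- E)"
      by (simp add: card_cartesian_product)
    also have "\<dots> \<le> real n ^ (D * L) * real n ^ (D * L) * exp (- E)"
      using card\<R> by (intro mult_right_mono mult_mono) auto
    also have "\<dots> = exp (2 * real D * real L * l - E)"
      by (simp add: n(2) exp_of_nat_mult[symmetric] exp_add[symmetric] algebra_simps)
    also have "\<dots> \<le> exp (4 * real n * l ^ 3 - real n powr (3 / 2) / (8 * (1 + 16 * l ^ 4) ^ 4))"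
    proof -
      have "2 * real D * real L * l \<le> real n * (4 * l ^ 2) * l"
        using D L l by (intro mult_right_mono mult_mono) auto
      also have "\<dots> = 4 * real n * l ^ 3" by (simp add: power2_eq_square power3_eq_cube)
      finally have 1: "2 * real D * real L * l \<le> 4 * real n * l ^ 3" .
      have "real L ^ 2 \<le> (4 * l ^ 2) ^ 2" using L(2) by (intro power_mono) auto
      then have "1 + real L ^ 2 \<le> 1 + 16 * l ^ 4" by (simp add: power_mult_distrib flip: power_mult)
      then have "(1 + real L ^ 2) ^ 4 \<le> (1 + 16 * l ^ 4) ^ 4" by (intro power_mono) auto
      moreover have "0 < (1 + real L ^ 2) ^ 4" by (intro zero_less_power add_pos_nonneg) auto
      ultimately have "real n powr (3 / 2) / (8 * (1 + 16 * l ^ 4) ^ 4) \<le>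
          real n powr (3 / 2) / (8 * (1 + real L ^ 2) ^ 4)"
        by (intro frac_le) simp_all
      also have "\<dots> = E"
      proof -
        have "real n powr (3 / 2) = exp (- 1 / (2 * p)) * real n ^ 2"
          using n by (simp add: p_def powr_def exp_of_nat_mult[symmetric] exp_add[symmetric])
        then show ?thesis
          by (simp add: E_def power_divide power_mult_distrib flip: power_mult)
      qed
      finally show ?thesis using 1 by (simp only: exp_le_cancel_iff)
    qed
    finally show ?thesis .
  qed
  finally show ?thesis by (simp add: C_def p_def)
qed

theorem mainTheorem2:
  shows "\<exists>c\<^sub>1>0. (\<lambda>n::nat. measure_pmf.prob (random_bipartite_graph n (1 / ln (real n)))
           {G. real (boxicity G) \<ge> c\<^sub>1 * sqrt (real (card (edges G)) * ln (real n) / 2)})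
         \<longlonglongrightarrow> 1"
proof (intro exI[of _ "1 / 512"] conjI)
  let ?prob = "\<lambda>n. measure_pmf.prob (random_bipartite_graph n (1 / ln (real n)))
    {G. real (boxicity G) \<ge> 1 / 512 * sqrt (real (card (edges G)) * ln (real n) / 2)}"
  let ?bound = "\<lambda>n::nat. exp (- (real n ^ 2 / ln (real n))) + 1 / real n +
      exp (4 * real n * ln (real n) ^ 3 - real n powr (3 / 2) / (8 * (1 + 16 * ln (real n) ^ 4) ^ 4))"
  have large: "\<forall>\<^sub>F n::nat in sequentially. 2 \<le> ln (real n) \<and> 4 * ln (real n) ^ 2 \<le> real n"
    by (intro eventually_conj; real_asymp)
  have "\<forall>\<^sub>F n in sequentially. 1 - ?bound n \<le> ?prob n"
    using large
  proof eventually_elim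
    case (elim n)
    let ?coins = "coins ({..<n} \<times> {..<n}) (1 / ln (real n))"
    let ?good = "{X. 1 / 512 * sqrt (real (card (edges (bipartite_graph_of n X))) * ln (real n) / 2)
      \<le> real (boxicity (bipartite_graph_of n X))}"
    have "?prob n = measure_pmf.prob ?coins ?good"
      by (simp add: random_bipartite_graph_def vimage_def)
    also have "\<dots> = 1 - measure_pmf.prob ?coins (- ?good)"
      using measure_pmf.prob_compl[of ?good ?coins] by (simp add: Compl_eq_Diff_UNIV)
    also have "- ?good = {X. \<not> 1 / 512 * sqrt (real (card (edges (bipartite_graph_of n X))) * ln (real n) / 2)
      \<le> real (boxicity (bipartite_graph_of n X))}" by blast
    finally show ?case
      using prob_small_boxicity_le[of n] elim by linarith
  qed
  moreover have "\<forall>\<^sub>F n in sequentially. ?prob n \<le> 1" by simp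
  moreover have "(\<lambda>n. 1 - ?bound n) \<longlonglongrightarrow> 1"
    using tendsto_diff[OF tendsto_const[of 1] bound_tendsto_0] by simp
  ultimately show "?prob \<longlonglongrightarrow> 1"
    by (rule tendsto_sandwich[OF _ _ _ tendsto_const])
qed simp

end
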